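(* Let $A\in\mathbb R^{n\times n}$ be normal, i.e. $A^T=q(A)$ for a polynomial $q$. Further, let $(\mathcal A,\mathcal M,\Phi)$ be the signal model for which $A$ is the shift matrix, with module $\mathcal M$ the polynomial algebra modulo a separable polynomial $p(x)$, obtained by the construction described in the context. Then this model has a unitary Fourier transform, and every such unitary Fourier transform is a KLT for the GMRF defined by $A$ via $(I_n-A)\mathbf s=\boldsymbol\nu$. The converse holds if and only if the polynomial $$(1-x)(1-q(x))$$ generates $\mathcal A$, or equivalently, if $(1-x)(1-q(x))$ is an injective mapping on the zeros of $p$.
   Context: A real matrix $A$ is normal if $AA^T=A^TA$; this holds if and only if $A^T$ is a polynomial in $A$. Signal model: a triple $(\mathcal A,\mathcal M,\Phi)$ of an algebra $\mathcal A$ (filters), an $\mathcal A$-module $\mathcal M$ (signals), and a bijective linear map $\Phi$ from the vector space of signals onto $\mathcal M$, which fixes a basis of $\mathcal M$. For a filter $h$, $\phi(h)$ is the matrix of $s\mapsto hs$ on $\mathcal M$ with respect to this basis. The shift is the chosen generator of $\mathcal A$, and the shift matrix is its image under $\phi$. Construction of the model with shift matrix $A$: for every diagonalizable $A\in\mathbb C^{n\times n}$ there exist a module $\mathcal M=\mathbb C[x]/p(x)$ with $p$ separable (pairwise distinct zeros) of degree $n$, a basis of $\mathcal M$, and an element $r(x)\in\mathbb C[x]/p(x)$ with $\phi(r(x))=A$; the filter algebra $\mathcal A$ is the subalgebra of $\mathbb C[x]/p(x)$ generated by the shift $r(x)$, and $\mathcal A\cong\mathbb C[x]/m_A(x)$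 with $m_A$ the minimal polynomial of $A$. This applies here since normal matrices are diagonalizable. A Fourier transform for the model is an invertible matrix $\mathcal F$ such that $\mathcal F\phi(h)\mathcal F^{-1}$ is diagonal for all $h\in\mathcal A$. The GMRF (Gauss-Markov random field) defined by $A$ is a random vector $\mathbf s$ with $(I_n-A)\mathbf s=\boldsymbol\nu$, where $\boldsymbol\nu$ is zero-mean Gaussian noise and $I_n-A$ has full rank. Its covariance is $\Sigma_{\mathbf s}=\sigma^2(I_n-A)^{-1}$ if $A$ is symmetric and $I_n-A$ is positive definite (noise covariance $\sigma^2(I_n-A)$); $\Sigma_{\mathbf s}=\sigma^2(I_n-A)^{-2}$ if $A$ is symmetric and $I_n-A$ has negative eigenvalues (noise covariance $\sigma^2I_n$); and $\Sigma_{\mathbf s}=\sigma^2(I_n-A)^{-1}(I_n-A^T)^{-1}$ if $A$ is not symmetric (noise covariance $\sigma^2I_n$). A KLT (Karhunen-Loève transform) for the GMRF is a unitary matrix $F$ such that $F\Sigma_{\mathbf s}F^{-1}$ is diagonal. "The converse" means: every KLT for the GMRF is a unitary Fourier transform for the signal model.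
   Formalization: In (1-x)(1-q(x)), x is read as the shift r(x); injectivity is required on the values of r at the zeros of p, not on the zeros of p themselves (false in general: A=0, n=2, q=x, r=0, p=x(x-2)). For r(x)=x the literal claim is proved. *)

theory Defs
  imports "HOL-Probability.Probability" "HOL-Computational_Algebra.Computational_Algebra"
begin

section \<open>Matrices\<close>

text \<open>On \<open>'a ^ 'n ^ 'n\<close> the operation \<open>*\<close> and its powers act entrywise; hence the iterate of \<open>**\<close>.\<close>

definition matrix_poly :: "'a::comm_ring_1 poly \<Rightarrow> 'a ^ 'n ^ 'n \<Rightarrow> 'a ^ 'n ^ 'n" where
  "matrix_poly q A = (\<Sum>i\<le>degree q. map_matrix ((*) (coeff q i)) (((**) A ^^ i) (mat 1)))"

definition diagonal_matrix :: "'a::zero ^ 'n ^ 'n \<Rightarrow> bool" where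
  "diagonal_matrix D \<longleftrightarrow> (\<forall>i j. i \<noteq> j \<longrightarrow> D $ i $ j = 0)"

definition unitary_matrix :: "complex ^ 'n ^ 'n \<Rightarrow> bool" where
  "unitary_matrix F \<longleftrightarrow>
     F ** map_matrix cnj (transpose F) = mat 1 \<and> map_matrix cnj (transpose F) ** F = mat 1"

definition eigenvalue :: "real ^ 'n ^ 'n \<Rightarrow> real \<Rightarrow> bool" where
  "eigenvalue B c \<longleftrightarrow> (\<exists>v. v \<noteq> 0 \<and> B *v v = c *s v)"

definition positive_definite :: "real ^ 'n ^ 'n \<Rightarrow> bool" where
  "positive_definite B \<longleftrightarrow> transpose B = B \<and> (\<forall>v. v \<noteq> 0 \<longrightarrow> v \<bullet> (B *v v) > 0)"

abbreviation complex_matrix :: "real ^ 'n ^ 'n \<Rightarrow> complex ^ 'n ^ 'n" where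
  "complex_matrix \<equiv> map_matrix complex_of_real"

section \<open>Signal models\<close>

text \<open>The elements of \<open>\<complex>[x]/p(x)\<close> are represented by their remainders modulo \<open>p\<close>. Sums and scalar
  multiples of remainders are remainders; products have to be reduced.\<close>

definition residue_polys :: "complex poly \<Rightarrow> complex poly set" where
  "residue_polys p = range (\<lambda>f. f mod p)"

definition quot_subalgebra :: "complex poly \<Rightarrow> complex poly set \<Rightarrow> bool" where
  "quot_subalgebra p B \<longleftrightarrow>
     B \<subseteq> residue_polys p \<and> 1 mod p \<in> B \<and>
     (\<forall>f\<in>B. \<forall>g\<in>B. f + g \<in> B \<and> (f * g) mod p \<in> B) \<and>
     (\<forall>c. \<forall>f\<in>B. smult c f \<in> B)"

definition generated_algebra :: "complex poly \<Rightarrow> complex poly \<Rightarrow> complex poly set" where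
  "generated_algebra p r = \<Inter>{B. quot_subalgebra p B \<and> r \<in> B}"

text \<open>The model with filter algebra \<open>\<A>\<close>, module \<open>\<complex>[x]/p(x)\<close> and signal space \<open>\<complex>\<^sup>n\<close>. The basis of the
  module fixed by \<open>\<Phi>\<close> consists of the polynomials \<open>\<Phi> (axis j 1)\<close>, so that \<open>inv \<Phi>\<close> gives
  the coordinates with respect to it.\<close>

definition signal_model ::
    "complex poly set \<Rightarrow> complex poly \<Rightarrow> (complex ^ 'n \<Rightarrow> complex poly) \<Rightarrow> bool" where
  "signal_model \<A> p \<Phi> \<longleftrightarrow>
     rsquarefree p \<and> degree p = CARD('n) \<and> quot_subalgebra p \<A> \<and>
     Vector_Spaces.linear (*s) smult \<Phi> \<and> bij_betw \<Phi> UNIV (residue_polys p)"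

definition filter_matrix ::
    "complex poly \<Rightarrow> (complex ^ 'n \<Rightarrow> complex poly) \<Rightarrow> complex poly \<Rightarrow> complex ^ 'n ^ 'n" where
  "filter_matrix p \<Phi> h = matrix (\<lambda>s. inv \<Phi> ((h * \<Phi> s) mod p))"

definition signal_model_with_shift ::
    "complex poly set \<Rightarrow> complex poly \<Rightarrow> (complex ^ 'n \<Rightarrow> complex poly) \<Rightarrow>
     complex poly \<Rightarrow> complex ^ 'n ^ 'n \<Rightarrow> bool" where
  "signal_model_with_shift \<A> p \<Phi> r A \<longleftrightarrow>
     signal_model \<A> p \<Phi> \<and> r \<in> residue_polys p \<and> \<A> = generated_algebra p r \<and>
     filter_matrix p \<Phi> r = A"

definition fourier_transform ::
    "complex poly set \<Rightarrow> complex poly \<Rightarrow> (complex ^ 'n \<Rightarrow> complex poly) \<Rightarrow> complex ^ 'n ^ 'n \<Rightarrow> bool"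
  where
  "fourier_transform \<A> p \<Phi> F \<longleftrightarrow>
     invertible F \<and> (\<forall>h\<in>\<A>. diagonal_matrix (F ** filter_matrix p \<Phi> h ** matrix_inv F))"

section \<open>Gauss-Markov random fields\<close>

text \<open>A random vector is Gaussian if all its linear combinations are normal random variables, where
  constants count as normal.\<close>

definition gaussian_variable :: "'w measure \<Rightarrow> ('w \<Rightarrow> real) \<Rightarrow> bool" where
  "gaussian_variable M X \<longleftrightarrow>
     X \<in> borel_measurable M \<and>
     (\<exists>\<mu>. (AE \<omega> in M. X \<omega> = \<mu>) \<or> (\<exists>\<tau>>0. distributed M lborel X (normal_density \<mu> \<tau>)))"

definition gaussian_vector :: "'w measure \<Rightarrow> ('w \<Rightarrow> real ^ 'n) \<Rightarrow> bool" where
  "gaussian_vector M X \<longleftrightarrow> (\<forall>a. gaussian_variable M (\<lambda>\<omega>. a \<bullet> X \<omega>))"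

definition mean_vector :: "'w measure \<Rightarrow> ('w \<Rightarrow> real ^ 'n) \<Rightarrow> real ^ 'n" where
  "mean_vector M X = (\<chi> i. \<integral>\<omega>. X \<omega> $ i \<partial>M)"

definition covariance_matrix :: "'w measure \<Rightarrow> ('w \<Rightarrow> real ^ 'n) \<Rightarrow> real ^ 'n ^ 'n" where
  "covariance_matrix M X =
     (\<chi> i j. \<integral>\<omega>. (X \<omega> $ i - mean_vector M X $ i) * (X \<omega> $ j - mean_vector M X $ j) \<partial>M)"

text \<open>If \<open>\<nu>\<close> has covariance \<open>C\<close>, then \<open>s\<close> has covariance
  \<open>(I - A)\<^sup>-\<^sup>1 C (I - A\<^sup>T)\<^sup>-\<^sup>1\<close>; the three cases below thus give \<open>\<sigma>\<^sup>2 (I - A)\<^sup>-\<^sup>1\<close>,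
  \<open>\<sigma>\<^sup>2 (I - A)\<^sup>-\<^sup>2\<close> and \<open>\<sigma>\<^sup>2 (I - A)\<^sup>-\<^sup>1 (I - A\<^sup>T)\<^sup>-\<^sup>1\<close>. For invertible \<open>I - A\<close>, exactly one of
  them applies.\<close>

definition gmrf :: "'w measure \<Rightarrow> real \<Rightarrow> real ^ 'n ^ 'n \<Rightarrow> ('w \<Rightarrow> real ^ 'n) \<Rightarrow> bool" where
  "gmrf M \<sigma> A s \<longleftrightarrow>
     prob_space M \<and> \<sigma> > 0 \<and> invertible (mat 1 - A) \<and> s \<in> borel_measurable M \<and>
     (\<exists>\<nu>. (\<forall>\<omega>\<in>space M. (mat 1 - A) *v s \<omega> = \<nu> \<omega>) \<and>
        gaussian_vector M \<nu> \<and> mean_vector M \<nu> = 0 \<and>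
        (transpose A = A \<and> positive_definite (mat 1 - A) \<longrightarrow>
           covariance_matrix M \<nu> = \<sigma>\<^sup>2 *\<^sub>R (mat 1 - A)) \<and>
        (transpose A = A \<and> (\<exists>c<0. eigenvalue (mat 1 - A) c) \<longrightarrow>
           covariance_matrix M \<nu> = \<sigma>\<^sup>2 *\<^sub>R mat 1) \<and>
        (transpose A \<noteq> A \<longrightarrow>
           covariance_matrix M \<nu> = \<sigma>\<^sup>2 *\<^sub>R mat 1))"

definition klt :: "'w measure \<Rightarrow> ('w \<Rightarrow> real ^ 'n) \<Rightarrow> complex ^ 'n ^ 'n \<Rightarrow> bool" where
  "klt M s F \<longleftrightarrow>
     unitary_matrix F \<and>
     diagonal_matrix (F ** complex_matrix (covariance_matrix M s) ** matrix_inv F)"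

end

theory Submission
  imports Defs
begin

text \<open>Let \<open>\<phi> h\<close> be the matrix of multiplication by \<open>h\<close> on \<open>\<complex>[x]/p\<close>. Since \<open>p\<close> is separable, \<open>\<phi> h\<close>
  depends only on the values of \<open>h\<close> on the zeros \<open>z\<close> of \<open>p\<close>, which are also its eigenvalues \<open>h(z)\<close>
  with common eigenvectors. As \<open>\<A>\<close> consists of the polynomials in the shift \<open>r\<close>, a unitary Fourier
  transform is a unitary matrix that diagonalizes \<open>A = \<phi> r\<close>. It exists because \<open>A\<^sup>T = q(A)\<close> makes orthogonal
  complements of eigenvectors invariant.

  The inverse of the covariance is a multiple of \<open>k(A)\<close> with \<open>k = 1 - x\<close> or \<open>k = (1 - x) (1 - q)\<close>, so
  a KLT is a unitary matrix that diagonalizes \<open>k(A)\<close>. If \<open>k\<close> is injective on the spectrum, then \<open>A\<close> is a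
  polynomial in \<open>k(A)\<close> by interpolation; if \<open>k\<close> identifies two eigenvalues, then mixing two of its
  eigenvectors keeps \<open>k(A)\<close> diagonal but not \<open>A\<close>. In the positive definite case, \<open>k = 1 - x\<close> and
  \<open>(1 - x) (1 - q) = (1 - x)\<^sup>2\<close> are both injective on the spectrum, which lies in \<open>x < 1\<close>.\<close>

no_notation fps_nth (infixl \<open>$\<close> 75)

section \<open>Inverses, scalar matrices and diagonal matrices\<close>

lemma matrix_inv_eqI:
  fixes X Y :: "'a::field ^ 'n ^ 'n"
  assumes "X ** Y = mat 1"
  shows "matrix_inv X = Y"
proof -
  have YX: "Y ** X = mat 1" using assms by (simp add: matrix_left_right_inverse)
  have "X ** matrix_inv X = mat 1 \<and> matrix_inv X ** X = mat 1"
    unfolding matrix_inv_def by (rule someI[of _ Y]) (use assms YX in simp)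
  then show ?thesis
    by (metis YX matrix_mul_assoc matrix_mul_lid matrix_mul_rid)
qed

lemma matrix_inv_cancel:
  fixes X :: "'a::field ^ 'n ^ 'n"
  assumes "invertible X"
  shows "X ** matrix_inv X = mat 1" "matrix_inv X ** X = mat 1"
  using assms matrix_inv_eqI unfolding invertible_def by metis+

lemma matrix_mul_add_left: "(X + Y) ** Z = X ** Z + Y ** (Z :: 'a::semiring_1 ^ 'n ^ 'm)"
  by (simp add: vec_eq_iff matrix_matrix_mult_def distrib_right sum.distrib)

lemma mat_mult_component [simp]: "(mat c ** X) $ i $ j = c * X $ i $ j"
  by (simp add: matrix_matrix_mult_def mat_def if_distrib[of "\<lambda>x. x * _"] cong: if_cong)

lemma mult_mat_component [simp]:
  "(X ** mat c) $ i $ j = X $ i $ j * (c :: 'a::comm_semiring_1)"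
  by (simp add: matrix_matrix_mult_def mat_def if_distrib[of "\<lambda>x. _ * x"] cong: if_cong)

lemma mat_mult_commute: "mat c ** X = X ** mat (c :: 'a::comm_semiring_1)"
  by (simp add: vec_eq_iff mult.commute)

lemma mat_vector_mult [simp]: "mat c *v v = c *s (v :: 'a::comm_semiring_1 ^ 'n)"
  by (simp add: vec_eq_iff matrix_vector_mult_def mat_def if_distrib[of "\<lambda>x. x * _"] cong: if_cong)

lemma vector_mult_smult: "X *v (c *s v) = c *s (X *v (v :: 'a::comm_semiring_1 ^ 'n))"
  by (simp add: vec_eq_iff matrix_vector_mult_def sum_distrib_left mult.left_commute)

lemma map_matrix_times: "map_matrix ((*) c) X = mat c ** X"
  by (simp add: vec_eq_iff)

lemma complex_matrix_mult: "complex_matrix (X ** Y) = complex_matrix X ** complex_matrix Y"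
  by (simp add: vec_eq_iff matrix_matrix_mult_def)

lemma complex_matrix_mat [simp]: "complex_matrix (mat c) = mat (complex_of_real c)"
  by (simp add: vec_eq_iff mat_def)

lemma complex_matrix_diff: "complex_matrix (X - Y) = complex_matrix X - complex_matrix Y"
  by (simp add: vec_eq_iff)

lemma diagonal_matrix_mult:
  assumes "diagonal_matrix X" "diagonal_matrix Y"
  shows "diagonal_matrix (X ** (Y :: 'a::semiring_1 ^ 'n ^ 'n))"
proof -
  have "X $ i $ k * Y $ k $ j = 0" if "i \<noteq> j" for i j k
    using assms that unfolding diagonal_matrix_def by (cases "i = k") auto
  then show ?thesis
    unfolding diagonal_matrix_def by (simp add: matrix_matrix_mult_def)
qed

lemma diagonal_matrix_left_mult_component:
  assumes "diagonal_matrix X"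
  shows "(X ** Y) $ i $ j = X $ i $ i * (Y :: 'a::semiring_1 ^ 'n ^ 'n) $ i $ j"
proof -
  have "(X ** Y) $ i $ j = (\<Sum>k\<in>UNIV. if k = i then X $ i $ i * Y $ i $ j else 0)"
    unfolding matrix_matrix_mult_def vec_lambda_beta
    by (rule sum.cong) (use assms in \<open>auto simp: diagonal_matrix_def\<close>)
  then show ?thesis by simp
qed

lemma diagonal_matrix_right_mult_component:
  assumes "diagonal_matrix X"
  shows "(Y ** X) $ i $ j = (Y :: 'a::semiring_1 ^ 'n ^ 'n) $ i $ j * X $ j $ j"
proof -
  have "(Y ** X) $ i $ j = (\<Sum>k\<in>UNIV. if k = j then Y $ i $ j * X $ j $ j else 0)"
    unfolding matrix_matrix_mult_def vec_lambda_beta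
    by (rule sum.cong) (use assms in \<open>auto simp: diagonal_matrix_def\<close>)
  then show ?thesis by simp
qed

lemma diagonal_matrix_vector_component:
  assumes "diagonal_matrix X"
  shows "(X *v v) $ i = X $ i $ i * (v :: 'a::semiring_1 ^ 'n) $ i"
proof -
  have "(X *v v) $ i = (\<Sum>k\<in>UNIV. if k = i then X $ i $ i * v $ i else 0)"
    unfolding matrix_vector_mult_def vec_lambda_beta
    by (rule sum.cong) (use assms in \<open>auto simp: diagonal_matrix_def\<close>)
  then show ?thesis by simp
qed

section \<open>Closure properties of diagonalization by a fixed matrix\<close>

definition diagonalizes :: "'a::field ^ 'n ^ 'n \<Rightarrow> 'a ^ 'n ^ 'n \<Rightarrow> bool" where
  "diagonalizes F X \<longleftrightarrow> diagonal_matrix (F ** X ** matrix_inv F)"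

lemma conjugate_mat:
  fixes F :: "'a::field ^ 'n ^ 'n"
  shows "invertible F \<Longrightarrow> F ** mat c ** matrix_inv F = mat c"
  unfolding mat_mult_commute[of c F, symmetric] matrix_mul_assoc[symmetric]
  by (simp add: matrix_inv_cancel)

lemma diagonalizes_mat: "invertible F \<Longrightarrow> diagonalizes F (mat c)"
  by (simp add: diagonalizes_def conjugate_mat) (simp add: diagonal_matrix_def mat_def)

lemma diagonalizes_add:
  "diagonalizes F X \<Longrightarrow> diagonalizes F Y \<Longrightarrow> diagonalizes F (X + Y)"
  unfolding diagonalizes_def by (simp add: diagonal_matrix_def matrix_add_ldistrib matrix_mul_add_left)

lemma conjugate_mult:
  fixes F :: "'a::field ^ 'n ^ 'n"
  assumes "invertible F"
  shows "F ** (X ** Y) ** matrix_inv F = (F ** X ** matrix_inv F) ** (F ** Y ** matrix_inv F)"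
proof -
  have "(F ** X ** matrix_inv F) ** (F ** Y ** matrix_inv F)
      = F ** X ** (matrix_inv F ** F) ** Y ** matrix_inv F"
    by (simp only: matrix_mul_assoc)
  then show ?thesis using assms by (simp add: matrix_inv_cancel matrix_mul_assoc)
qed

lemma diagonalizes_mult:
  "invertible F \<Longrightarrow> diagonalizes F X \<Longrightarrow> diagonalizes F Y \<Longrightarrow> diagonalizes F (X ** Y)"
  unfolding diagonalizes_def by (simp add: conjugate_mult diagonal_matrix_mult)

text \<open>Carries diagonalization from a covariance to its inverse and back. Row \<open>i\<close>
  of \<open>D ** E = mat c\<close> is \<open>D $ i $ i\<close> times row \<open>i\<close> of
  \<open>E\<close>; the diagonal entry forces \<open>D $ i $ i\<close> to be nonzero, so the
  off-diagonal entries of \<open>E\<close> vanish.\<close>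

lemma diagonalizes_of_mult_eq_mat:
  fixes F :: "'a::field ^ 'n ^ 'n"
  assumes F: "invertible F" and X: "diagonalizes F X" and XY: "X ** Y = mat c" and c: "c \<noteq> 0"
  shows "diagonalizes F Y"
proof -
  define D E where "D = F ** X ** matrix_inv F" and "E = F ** Y ** matrix_inv F"
  have D: "diagonal_matrix D" using X by (simp add: D_def diagonalizes_def)
  have "D ** E = mat c"
    unfolding D_def E_def conjugate_mult[OF F, symmetric] XY conjugate_mat[OF F] ..
  then have DE: "D $ i $ i * E $ i $ j = (if i = j then c else 0)" for i j
    using diagonal_matrix_left_mult_component[OF D, of E i j] by (simp add: mat_def)
  have "E $ i $ j = 0" if "i \<noteq> j" for i j
    using DE[of i i] DE[of i j] that c by auto
  then show ?thesis by (simp add: diagonalizes_def diagonal_matrix_def flip: E_def)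
qed

text \<open>Dividing \<open>Y\<close> by \<open>c\<close> gives a right inverse of the square matrix
  \<open>X\<close>, hence a left inverse.\<close>

lemma mult_eq_mat_commute:
  fixes X Y :: "'a::field ^ 'n ^ 'n"
  assumes "X ** Y = mat c" "c \<noteq> 0"
  shows "Y ** X = mat c"
proof -
  have c: "mat a ** mat b = (mat (a * b) :: 'a ^ 'n ^ 'n)" for a b :: 'a
    by (simp add: vec_eq_iff) (simp add: mat_def)
  have "X ** (Y ** mat (1 / c)) = mat 1"
    unfolding matrix_mul_assoc assms(1) c using assms(2) by simp
  then have "Y ** mat (1 / c) ** X = mat 1" by (simp add: matrix_left_right_inverse)
  then have "mat (1 / c) ** (Y ** X) = mat 1"
    by (simp only: mat_mult_commute[of "1 / c" Y, symmetric] matrix_mul_assoc)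
  then have "mat c ** mat (1 / c) ** (Y ** X) = mat c" by (simp flip: matrix_mul_assoc)
  then show ?thesis unfolding c using assms(2) by simp
qed

lemma diagonalizes_iff_of_mult_eq_mat:
  assumes "invertible F" "X ** Y = mat c" "c \<noteq> 0"
  shows "diagonalizes F X \<longleftrightarrow> diagonalizes F Y"
  using diagonalizes_of_mult_eq_mat assms mult_eq_mat_commute by metis

lemma unitary_matrix_invertible: "unitary_matrix F \<Longrightarrow> invertible F"
  unfolding unitary_matrix_def invertible_def by blast

section \<open>Unitary diagonalization\<close>

definition adjoint_matrix :: "complex ^ 'n ^ 'n \<Rightarrow> complex ^ 'n ^ 'n" where
  "adjoint_matrix X = map_matrix cnj (transpose X)"

lemma adjoint_matrix_component [simp]: "adjoint_matrix X $ i $ j = cnj (X $ j $ i)"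
  by (simp add: adjoint_matrix_def transpose_def)

lemma adjoint_matrix_mult: "adjoint_matrix (X ** Y) = adjoint_matrix Y ** adjoint_matrix X"
  by (simp add: vec_eq_iff matrix_matrix_mult_def mult.commute)

lemma unitary_matrixI: "F ** adjoint_matrix F = mat 1 \<Longrightarrow> unitary_matrix F"
  unfolding unitary_matrix_def adjoint_matrix_def by (simp add: matrix_left_right_inverse)

lemma unitary_matrix_mult_adjoint: "unitary_matrix F \<Longrightarrow> F ** adjoint_matrix F = mat 1"
  by (simp add: unitary_matrix_def adjoint_matrix_def)

lemma matrix_inv_unitary: "unitary_matrix F \<Longrightarrow> matrix_inv F = adjoint_matrix F"
  by (rule matrix_inv_eqI) (rule unitary_matrix_mult_adjoint)

lemma unitary_matrix_mult:
  assumes "unitary_matrix F" "unitary_matrix G"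
  shows "unitary_matrix (F ** G)"
proof (rule unitary_matrixI)
  have "F ** G ** adjoint_matrix (F ** G) = F ** (G ** adjoint_matrix G) ** adjoint_matrix F"
    by (simp only: adjoint_matrix_mult matrix_mul_assoc)
  then show "F ** G ** adjoint_matrix (F ** G) = mat 1"
    using assms by (simp add: unitary_matrix_mult_adjoint)
qed

text \<open>The standard Hermitian form, conjugate-linear in the first argument;
  \<open>\<bullet>\<close> on complex vectors is only its real part.\<close>

definition hinner :: "complex ^ 'n \<Rightarrow> complex ^ 'n \<Rightarrow> complex" where
  "hinner u v = (\<Sum>i\<in>UNIV. cnj (u $ i) * v $ i)"

lemma hinner_add_right: "hinner u (v + w) = hinner u v + hinner u w"
  by (simp add: hinner_def distrib_left sum.distrib)

lemma hinner_smult_right: "hinner u (c *s v) = c * hinner u v"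
  by (simp add: hinner_def sum_distrib_left mult.left_commute)

lemma hinner_smult_left: "hinner (c *s u) v = cnj c * hinner u v"
  by (simp add: hinner_def sum_distrib_left mult.assoc)

lemma hinner_commute: "hinner u v = cnj (hinner v u)"
  by (simp add: hinner_def mult.commute)

lemma hinner_zero_right [simp]: "hinner u 0 = 0"
  by (simp add: hinner_def)

lemma hinner_matrix_right: "hinner u (X *v v) = hinner (adjoint_matrix X *v u) v"
  unfolding hinner_def matrix_vector_mult_def
  by (simp add: sum_distrib_left sum_distrib_right mult_ac) (subst sum.swap, simp add: mult_ac)

lemma hinner_self: "hinner u u = complex_of_real ((norm u)\<^sup>2)"
  by (simp add: hinner_def norm_vec_def L2_set_def sum_nonneg complex_norm_square mult.commute
      flip: of_real_power)

text \<open>The index \<open>j\<close> outside \<open>I\<close> leaves a zero row in the matrix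
  whose rows for \<open>i \<in> I\<close> are the conjugates of \<open>u i\<close>. This matrix is
  therefore singular and has a nonzero kernel vector.\<close>

lemma ex_orthogonal_vector:
  fixes u :: "'n \<Rightarrow> complex ^ 'n"
  assumes "j \<notin> I"
  shows "\<exists>w. w \<noteq> 0 \<and> (\<forall>i\<in>I. hinner (u i) w = 0)"
proof -
  define B :: "complex ^ 'n ^ 'n" where "B = (\<chi> i k. if i \<in> I then cnj (u i $ k) else 0)"
  have "row j B = 0" using assms by (simp add: B_def row_def vec_eq_iff)
  then have "\<not> invertible B" by (simp add: invertible_det_nz det_zero_row)
  then obtain w where w: "w \<noteq> 0" "B *v w = 0"
    using matrix_left_invertible_ker[of B] by (auto simp: invertible_left_inverse)
  have "hinner (u i) w = (B *v w) $ i" if "i \<in> I" for i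
    using that by (simp add: B_def hinner_def matrix_vector_mult_def)
  then show ?thesis using w by auto
qed

lemma ex_orthonormal_eigenvectors:
  fixes X :: "complex ^ 'n ^ 'n" and I :: "'n set"
  assumes adj: "\<forall>v c. X *v v = c *s v \<longrightarrow> (\<exists>d. adjoint_matrix X *v v = d *s v)"
    and eig: "\<forall>W. vec.subspace W \<longrightarrow> (\<forall>v\<in>W. X *v v \<in> W) \<longrightarrow> W \<noteq> {0} \<longrightarrow>
                (\<exists>v\<in>W. v \<noteq> 0 \<and> (\<exists>c. X *v v = c *s v))"
  shows "\<exists>u. (\<forall>i\<in>I. \<exists>c. X *v u i = c *s u i) \<and>
             (\<forall>i\<in>I. \<forall>j\<in>I. hinner (u i) (u j) = (if i = j then 1 else 0))"
proof (induction I rule: infinite_finite_induct)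
  case (insert j I)
  then obtain u where u: "\<And>i. i \<in> I \<Longrightarrow> \<exists>c. X *v u i = c *s u i"
      "\<And>i k. i \<in> I \<Longrightarrow> k \<in> I \<Longrightarrow> hinner (u i) (u k) = (if i = k then 1 else 0)"
    by blast
  define W where "W = {w. \<forall>i\<in>I. hinner (u i) w = 0}"
  have W: "vec.subspace W"
    unfolding vec.subspace_def by (simp add: W_def hinner_add_right hinner_smult_right)
  have inv: "X *v v \<in> W" if "v \<in> W" for v
    unfolding W_def
  proof (intro CollectI ballI)
    fix i assume i: "i \<in> I"
    then obtain d where "adjoint_matrix X *v u i = d *s u i" using u(1) adj by blast
    then show "hinner (u i) (X *v v) = 0"
      using that i by (simp add: hinner_matrix_right hinner_smult_left W_def)
  qed
  obtain w where "w \<in> W" "w \<noteq> 0" using ex_orthogonal_vector[OF insert(2)] W_def by blast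
  then have "W \<noteq> {0}" by blast
  then obtain v c where v: "v \<in> W" "v \<noteq> 0" "X *v v = c *s v"
    using eig W inv by metis
  define e where "e = complex_of_real (1 / norm v) *s v"
  have e1: "X *v e = c *s e"
    using v by (simp add: e_def vector_mult_smult vector_smult_assoc mult.commute)
  have e2: "hinner e e = 1"
    using v(2) unfolding e_def hinner_smult_left hinner_smult_right
    by (simp add: hinner_self field_simps power2_eq_square)
  have e3: "hinner (u i) e = 0" "hinner e (u i) = 0" if "i \<in> I" for i
    using v(1) that hinner_commute[of e "u i"] by (auto simp: e_def hinner_smult_right W_def)
  show ?case
    by (rule exI[of _ "u(j := e)"]) (use u e1 e2 e3 insert(2) in \<open>auto\<close>)
qed auto

lemma ex_unitary_diagonalization:
  fixes X :: "complex ^ 'n ^ 'n"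
  assumes adj: "\<forall>v c. X *v v = c *s v \<longrightarrow> (\<exists>d. adjoint_matrix X *v v = d *s v)"
    and eig: "\<forall>W. vec.subspace W \<longrightarrow> (\<forall>v\<in>W. X *v v \<in> W) \<longrightarrow> W \<noteq> {0} \<longrightarrow>
                (\<exists>v\<in>W. v \<noteq> 0 \<and> (\<exists>c. X *v v = c *s v))"
  shows "\<exists>F. unitary_matrix F \<and> diagonalizes F X"
proof -
  obtain u :: "'n \<Rightarrow> complex ^ 'n"
    where u1: "\<forall>i\<in>UNIV. \<exists>c. X *v u i = c *s u i"
      and u2: "\<forall>i\<in>UNIV. \<forall>j\<in>UNIV. hinner (u i) (u j) = (if i = j then 1 else 0)"
    using ex_orthonormal_eigenvectors[of X UNIV, OF adj eig] by blast
  obtain c where c: "\<And>i. X *v u i = c i *s u i" using bchoice[OF u1] by auto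
  note u = c u2[rule_format, OF UNIV_I UNIV_I]
  \<comment> \<open>With conjugated eigenvectors as rows, the entries of
    \<open>F ** X ** adjoint_matrix F\<close> are the numbers
    \<open>hinner (u i) (X *v u j)\<close>.\<close>
  define F :: "complex ^ 'n ^ 'n" where "F = (\<chi> i k. cnj (u i $ k))"
  have "(F ** adjoint_matrix F) $ i $ j = hinner (u i) (u j)" for i j
    by (simp add: F_def matrix_matrix_mult_def hinner_def)
  then have F: "unitary_matrix F"
    by (intro unitary_matrixI) (simp add: vec_eq_iff u mat_def)
  have "(F ** X ** adjoint_matrix F) $ i $ j = hinner (u i) (X *v u j)" for i j
    unfolding matrix_mul_assoc[symmetric]
    by (simp add: F_def matrix_matrix_mult_def hinner_def matrix_vector_mult_def)
  then have "diagonalizes F X"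
    by (simp add: diagonalizes_def diagonal_matrix_def matrix_inv_unitary[OF F] u hinner_smult_right)
  then show ?thesis using F by blast
qed

text \<open>The reflection below mixes the coordinates \<open>i\<close> and \<open>j\<close>; the vector \<open>2 e\<^sub>i + e\<^sub>j\<close> keeps its
  entries rational.\<close>

lemma ex_unitary_not_diagonalizing:
  fixes X Y F :: "complex ^ 'n ^ 'n"
  assumes F: "unitary_matrix F" and X: "diagonalizes F X" and Y: "diagonalizes F Y"
    and ij: "(F ** X ** matrix_inv F) $ i $ i = (F ** X ** matrix_inv F) $ j $ j"
            "(F ** Y ** matrix_inv F) $ i $ i \<noteq> (F ** Y ** matrix_inv F) $ j $ j"
  shows "\<exists>G. unitary_matrix G \<and> diagonalizes G X \<and> \<not> diagonalizes G Y"
proof -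
  define D E where "D = F ** X ** matrix_inv F" and "E = F ** Y ** matrix_inv F"
  have D: "diagonal_matrix D" "D $ i $ i = D $ j $ j"
    and E: "diagonal_matrix E" "E $ i $ i \<noteq> E $ j $ j"
    using X Y ij by (auto simp: D_def E_def diagonalizes_def)
  have "i \<noteq> j" using E by auto
  define w :: "'n \<Rightarrow> complex" where "w k = (if k = i then 2 else if k = j then 1 else 0)" for k
  \<comment> \<open>The factor is 2 divided by the squared norm 5 of \<open>w\<close>, which makes
    \<open>U\<close> the Householder reflection along \<open>w\<close>.\<close>
  define t :: complex where "t = 2/5"
  define U :: "complex ^ 'n ^ 'n" where "U = (\<chi> a b. (if a = b then 1 else 0) - t * w a * w b)"
  have w2: "(\<Sum>k\<in>UNIV. w k * w k) = 5"
  proof -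
    have "(\<Sum>k\<in>UNIV. w k * w k) = (\<Sum>k\<in>UNIV. (if k = i then 4 else 0) + (if k = j then 1 else 0))"
      by (intro sum.cong) (use \<open>i \<noteq> j\<close> in \<open>auto simp: w_def\<close>)
    then show ?thesis by (simp add: sum.distrib)
  qed
  have "(U ** U) $ a $ b = mat 1 $ a $ b" for a b
  proof -
    have "(U ** U) $ a $ b = (\<Sum>k\<in>UNIV. (if a = k then (if k = b then 1 else 0) - t * w k * w b else 0)
        - (if k = b then t * w a * w k else 0) + t * t * w a * w b * (w k * w k))"
      unfolding matrix_matrix_mult_def vec_lambda_beta
      by (rule sum.cong) (auto simp: U_def algebra_simps)
    also have "\<dots> = (if a = b then 1 else 0) - t * w a * w b - t * w a * w b + t * t * w a * w b * 5"
      unfolding sum.distrib sum_subtractf sum_distrib_left[symmetric] w2 by simp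
    also have "\<dots> = mat 1 $ a $ b" by (simp add: mat_def t_def)
    finally show ?thesis .
  qed
  then have UU: "U ** U = mat 1" by (simp add: vec_eq_iff)
  have adjU: "adjoint_matrix U = U" by (simp add: vec_eq_iff U_def w_def t_def)
  then have U: "unitary_matrix U" using UU by (simp add: unitary_matrixI)
  define G where "G = U ** F"
  have G: "unitary_matrix G" unfolding G_def by (rule unitary_matrix_mult[OF U F])
  have conj: "G ** Z ** matrix_inv G = U ** (F ** Z ** matrix_inv F) ** U" for Z
    unfolding matrix_inv_unitary[OF G] matrix_inv_unitary[OF F]
    by (simp add: G_def adjoint_matrix_mult adjU matrix_mul_assoc)
  \<comment> \<open>Off the diagonal \<open>U\<close> is nonzero only between \<open>i\<close> and
    \<open>j\<close>, where \<open>D\<close> has equal entries; hence \<open>U\<close> and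
    \<open>D\<close> commute.\<close>
  have "U $ a $ b * D $ b $ b = D $ a $ a * U $ a $ b" for a b
  proof (cases "U $ a $ b = 0")
    case False
    then have "a = b \<or> a \<in> {i, j} \<and> b \<in> {i, j}"
      by (auto simp: U_def w_def split: if_splits)
    then have "D $ a $ a = D $ b $ b" using D(2) by (metis insert_iff singletonD)
    then show ?thesis by (simp add: mult.commute)
  qed simp
  then have "U ** D = D ** U"
    by (simp add: vec_eq_iff diagonal_matrix_left_mult_component[OF D(1)]
        diagonal_matrix_right_mult_component[OF D(1)])
  then have "U ** D ** U = D" by (metis UU matrix_mul_assoc matrix_mul_rid)
  then have GX: "diagonalizes G X"
    using D by (simp add: diagonalizes_def conj flip: D_def)
  have "\<not> diagonalizes G Y"
  proof
    assume "diagonalizes G Y"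
    then have d: "diagonal_matrix (U ** E ** U)" by (simp add: diagonalizes_def conj flip: E_def)
    have "(U ** E ** U) ** U = U ** E" by (metis UU matrix_mul_assoc matrix_mul_rid)
    \<comment> \<open>In row \<open>i\<close> the matrix \<open>U\<close> is nonzero at the columns
      \<open>i\<close> and \<open>j\<close>, which forces \<open>E $ i $ i\<close> and
      \<open>E $ j $ j\<close> to equal the same diagonal entry.\<close>
    then have *: "(U ** E ** U) $ i $ i * U $ i $ k = U $ i $ k * E $ k $ k" for k
      using diagonal_matrix_left_mult_component[OF d, of U i k]
        diagonal_matrix_right_mult_component[OF E(1), of U i k] by metis
    have "U $ i $ i \<noteq> 0" "U $ i $ j \<noteq> 0"
      using \<open>i \<noteq> j\<close> by (auto simp: U_def w_def t_def)
    then show False using *[of i] *[of j] E(2) by simp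
  qed
  then show ?thesis using G GX by blast
qed

section \<open>Quotients of the polynomial ring\<close>

text \<open>Newton interpolation: the correction for the new node is a multiple of the product that
  vanishes at the old ones.\<close>

lemma ex_interpolating_poly:
  fixes c :: "'a::field \<Rightarrow> 'a"
  assumes "finite S"
  shows "\<exists>f. \<forall>y\<in>S. poly f y = c y"
  using assms
proof (induction S)
  case (insert x S)
  then obtain f where f: "\<forall>y\<in>S. poly f y = c y" by blast
  define k where "k = (\<Prod>y\<in>S. [:- y, 1:])"
  have k: "poly k y = (\<Prod>z\<in>S. y - z)" for y
    by (simp add: k_def poly_prod)
  have "poly k x \<noteq> 0" "\<forall>y\<in>S. poly k y = 0"
    using insert(1,2) by (auto simp: k)
  then show ?case using f
    by (intro exI[of _ "f + smult ((c x - poly f x) / poly k x) k"]) simp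
qed simp

lemma poly_mod_at_zero: "poly p z = 0 \<Longrightarrow> poly (f mod p) z = poly (f :: 'a::field poly) z"
  by (metis add_0 mult_div_mod_eq mult_zero_left poly_add poly_mult)

lemma card_zeros_rsquarefree:
  assumes "rsquarefree (p :: complex poly)"
  shows "card {z. poly p z = 0} = degree p"
proof -
  have "p \<noteq> 0" using assms by (auto simp: rsquarefree_def)
  then have "degree (smult (lead_coeff p) (\<Prod>z | poly p z = 0. [:- z, 1:])) = card {z. poly p z = 0}"
    by (simp add: degree_prod_eq_sum_degree)
  then show ?thesis using complex_poly_decompose_rsquarefree[OF assms] by simp
qed

text \<open>A remainder vanishing at all zeros of \<open>p\<close> is zero: separability gives
  \<open>degree p\<close> distinct zeros, more than the degree of the remainder.\<close>

lemma mod_eq_iff_eq_on_zeros: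
  assumes "rsquarefree (p :: complex poly)"
  shows "f mod p = g mod p \<longleftrightarrow> (\<forall>z. poly p z = 0 \<longrightarrow> poly f z = poly g z)"
proof
  assume "f mod p = g mod p"
  then show "\<forall>z. poly p z = 0 \<longrightarrow> poly f z = poly g z" by (metis poly_mod_at_zero)
next
  assume eq: "\<forall>z. poly p z = 0 \<longrightarrow> poly f z = poly g z"
  have p: "p \<noteq> 0" using assms by (auto simp: rsquarefree_def)
  define h where "h = (f - g) mod p"
  have "h = 0"
  proof (rule ccontr)
    assume h: "h \<noteq> 0"
    have "{z. poly p z = 0} \<subseteq> {z. poly h z = 0}"
      using eq by (auto simp: h_def poly_mod_at_zero)
    then have "degree p \<le> card {z. poly h z = 0}"
      using card_zeros_rsquarefree[OF assms] h by (metis card_mono poly_roots_finite)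
    also have "\<dots> \<le> degree h" using h by (rule card_poly_roots_bound)
    also have "\<dots> < degree p" using h p degree_mod_less[of p "f - g"] by (auto simp: h_def)
    finally show False by simp
  qed
  then show "f mod p = g mod p" by (simp add: h_def mod_eq_0_iff_dvd mod_eq_dvd_iff)
qed

lemma quot_subalgebra_range_pcompose:
  "quot_subalgebra p (range (\<lambda>f. pcompose f r mod p))" (is "quot_subalgebra p ?B")
  unfolding quot_subalgebra_def residue_polys_def
proof (intro conjI ballI allI)
  show "1 mod p \<in> ?B" by (rule range_eqI[of _ _ 1]) (simp add: pcompose_1)
next
  fix f g assume "f \<in> ?B" "g \<in> ?B"
  then obtain f' g' where fg: "f = pcompose f' r mod p" "g = pcompose g' r mod p" by blast
  show "f + g \<in> ?B"
    by (rule range_eqI[of _ _ "f' + g'"]) (simp add: fg pcompose_add poly_mod_add_left)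
  show "f * g mod p \<in> ?B"
    by (rule range_eqI[of _ _ "f' * g'"]) (simp add: fg pcompose_mult mod_mult_eq)
next
  fix c f assume "f \<in> ?B"
  then obtain f' where f: "f = pcompose f' r mod p" by blast
  show "smult c f \<in> ?B"
    by (rule range_eqI[of _ _ "smult c f'"]) (simp add: f pcompose_smult mod_smult_left)
qed auto

text \<open>The image of evaluation at \<open>r\<close> is a subalgebra containing \<open>r\<close>;
  conversely, Horner's rule builds every value from \<open>r\<close>, constants, sums and
  products.\<close>

lemma generated_algebra_eq_range:
  assumes "r \<in> residue_polys p"
  shows "generated_algebra p r = range (\<lambda>f. pcompose f r mod p)"
proof
  have "r mod p = r" using assms by (auto simp: residue_polys_def)
  then have "r \<in> range (\<lambda>f. pcompose f r mod p)"
    by (intro range_eqI[of _ _ "[:0, 1:]"]) (simp add: pcompose_pCons)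
  then show "generated_algebra p r \<subseteq> range (\<lambda>f. pcompose f r mod p)"
    unfolding generated_algebra_def using quot_subalgebra_range_pcompose by blast
next
  show "range (\<lambda>f. pcompose f r mod p) \<subseteq> generated_algebra p r"
    unfolding generated_algebra_def
  proof (intro Inter_greatest image_subsetI)
    fix B f assume "B \<in> {B. quot_subalgebra p B \<and> r \<in> B}"
    then have B: "quot_subalgebra p B" "r \<in> B" by auto
    show "pcompose f r mod p \<in> B"
    proof (induction f)
      case 0
      \<comment> \<open>\<open>quot_subalgebra\<close> does not list zero explicitly; it arises as a
        scalar multiple.\<close>
      have "smult 0 r \<in> B" using B unfolding quot_subalgebra_def by blast
      then show ?case by simp
    next
      case (pCons a f)
      have "pcompose (pCons a f) r mod p = smult a (1 mod p) + r * (pcompose f r mod p) mod p"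
        by (simp add: pcompose_pCons poly_mod_add_left mod_mult_right_eq flip: mod_smult_left)
      moreover have "smult a (1 mod p) + r * (pcompose f r mod p) mod p \<in> B"
        using B pCons unfolding quot_subalgebra_def by blast
      ultimately show ?case by simp
    qed
  qed
qed

text \<open>On the finite image of \<open>S\<close> the inverse of an injective \<open>g\<close> can
  be interpolated.\<close>

lemma ex_poly_left_inverse_iff:
  fixes g :: "'a::field poly"
  assumes "finite S"
  shows "(\<exists>f. \<forall>y\<in>S. poly f (poly g y) = y) \<longleftrightarrow> inj_on (poly g) S"
proof
  assume inj: "inj_on (poly g) S"
  obtain f where "\<forall>y\<in>poly g ` S. poly f y = inv_into S (poly g) y"
    using ex_interpolating_poly assms by blast
  then show "\<exists>f. \<forall>y\<in>S. poly f (poly g y) = y" using inj by auto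
qed (metis inj_onI)

text \<open>The algebra of \<open>g(r)\<close> lies in that of \<open>r\<close>, so equality means
  \<open>r = f(g(r))\<close> modulo \<open>p\<close> for some \<open>f\<close>. On the zeros of
  \<open>p\<close> this says that \<open>f\<close> inverts \<open>g\<close> at the values of
  \<open>r\<close>.\<close>

lemma generated_algebra_pcompose_eq_iff:
  assumes p: "rsquarefree p" and r: "r \<in> residue_polys p"
  shows "generated_algebra p (pcompose g r mod p) = generated_algebra p r \<longleftrightarrow>
    inj_on (poly g) (poly r ` {z. poly p z = 0})"
proof -
  define k where "k = pcompose g r mod p"
  have k: "k \<in> residue_polys p" by (simp add: k_def residue_polys_def)
  have r': "r = r mod p" using r by (auto simp: residue_polys_def)
  have fin: "finite {z. poly p z = 0}"
    using p by (auto simp: rsquarefree_def poly_roots_finite)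
  have sub: "generated_algebra p a \<subseteq> generated_algebra p b"
    if "a \<in> generated_algebra p b" "b \<in> residue_polys p" for a b
    using that quot_subalgebra_range_pcompose[of p b] generated_algebra_eq_range[of b p]
    unfolding generated_algebra_def[of p a] by auto
  have mem: "a \<in> generated_algebra p a" for a
    by (simp add: generated_algebra_def)
  have "k \<in> generated_algebra p r"
    using generated_algebra_eq_range[OF r] by (auto simp: k_def)
  then have "generated_algebra p k = generated_algebra p r \<longleftrightarrow> r \<in> generated_algebra p k"
    using sub[of k r] sub[of r k] mem[of r] r k by blast
  also have "\<dots> \<longleftrightarrow> (\<exists>f. r mod p = pcompose f k mod p)"
    using generated_algebra_eq_range[OF k] r' by auto
  also have "\<dots> \<longleftrightarrow> (\<exists>f. \<forall>y\<in>poly r ` {z. poly p z = 0}. poly f (poly g y) = y)"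
    unfolding mod_eq_iff_eq_on_zeros[OF p]
    by (intro iff_exI) (auto simp: poly_pcompose k_def poly_mod_at_zero)
  also have "\<dots> \<longleftrightarrow> inj_on (poly g) (poly r ` {z. poly p z = 0})"
    by (rule ex_poly_left_inverse_iff) (use fin in simp)
  finally show ?thesis by (simp add: k_def)
qed

section \<open>Horner's rule for polynomials of a matrix\<close>

lemma matrix_mult_sum_right: "X ** (\<Sum>i\<in>I. f i) = (\<Sum>i\<in>I. X ** f i)"
  by (induction I rule: infinite_finite_induct)
     (simp_all add: matrix_add_ldistrib)

text \<open>The bound \<open>N\<close> is left free since \<open>pCons a f\<close> has degree
  \<open>0\<close>, not \<open>Suc (degree f)\<close>, when \<open>f = 0\<close>.\<close>

lemma matrix_poly_eq_sum:
  assumes "degree q \<le> N"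
  shows "matrix_poly q A = (\<Sum>i\<le>N. mat (coeff q i) ** ((**) A ^^ i) (mat 1))"
  unfolding matrix_poly_def map_matrix_times
  by (rule sum.mono_neutral_left) (use assms in \<open>auto simp: coeff_eq_0 vec_eq_iff\<close>)

lemma matrix_poly_0: "matrix_poly 0 A = 0"
  by (simp add: matrix_poly_def vec_eq_iff)

lemma matrix_poly_pCons:
  fixes A :: "'a::comm_ring_1 ^ 'n ^ 'n"
  shows "matrix_poly (pCons a f) A = mat a + A ** matrix_poly f A"
proof -
  have "A ** (mat c ** X) = mat c ** (A ** X)" for c and X :: "'a ^ 'n ^ 'n"
    by (metis mat_mult_commute matrix_mul_assoc)
  then show ?thesis
    unfolding matrix_poly_eq_sum[OF degree_pCons_le] matrix_poly_eq_sum[OF order_refl, of f]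
    by (simp add: sum.atMost_Suc_shift matrix_mult_sum_right del: sum.atMost_Suc)
qed

section \<open>Filter matrices\<close>

text \<open>Only the module and its coordinates: \<open>\<phi>\<close> is studied as an algebra
  homomorphism on all polynomials, and filter algebras enter as sets of its arguments.\<close>

locale polynomial_module =
  fixes p :: "complex poly" and \<Phi> :: "complex ^ 'n \<Rightarrow> complex poly"
  assumes separable: "rsquarefree p"
    and linear: "Vector_Spaces.linear (*s) smult \<Phi>" and bij: "bij_betw \<Phi> UNIV (residue_polys p)"
begin

abbreviation \<phi> :: "complex poly \<Rightarrow> complex ^ 'n ^ 'n" where
  "\<phi> \<equiv> filter_matrix p \<Phi>"

lemma inj_\<Phi>: "\<Phi> x = \<Phi> y \<longleftrightarrow> x = y"
  using bij by (auto simp: bij_betw_def inj_on_def)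

lemma \<Phi>_mod: "\<Phi> x mod p = \<Phi> x"
  using bij by (auto simp: bij_betw_def residue_polys_def set_eq_iff image_iff) (metis mod_mod_trivial)

text \<open>\<open>\<Phi>\<close> reaches only remainders, so \<open>inv \<Phi>\<close> is
  meaningful only there.\<close>

lemma \<Phi>_inv: "f mod p = f \<Longrightarrow> \<Phi> (inv \<Phi> f) = f"
  using bij unfolding bij_betw_def residue_polys_def by (metis f_inv_into_f rangeI)

lemma \<Phi>_add: "\<Phi> (x + y) = \<Phi> x + \<Phi> y" and \<Phi>_smult: "\<Phi> (c *s x) = smult c (\<Phi> x)"
  using linear unfolding Vector_Spaces.linear_iff by auto

text \<open>Since \<open>\<Phi>\<close> is injective, this turns identities between filter matrices
  into congruences modulo \<open>p\<close>. Multiplication by \<open>h\<close> is linear, so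
  \<open>matrix\<close> represents it.\<close>

lemma \<Phi>_filter: "\<Phi> (\<phi> h *v x) = h * \<Phi> x mod p"
proof -
  have "Vector_Spaces.linear (*s) (*s) (\<lambda>x. inv \<Phi> (h * \<Phi> x mod p))"
    unfolding Vector_Spaces.linear_iff
    by (simp add: vec.vector_space_axioms flip: inj_\<Phi>)
       (simp add: \<Phi>_inv \<Phi>_add \<Phi>_smult distrib_left poly_mod_add_left mod_smult_left)
  then show ?thesis unfolding filter_matrix_def by (simp add: matrix_works \<Phi>_inv)
qed

lemma filter_matrix_eq_iff: "X = Y \<longleftrightarrow> (\<forall>x. \<Phi> (X *v x) = \<Phi> (Y *v x))"
  by (simp add: inj_\<Phi> matrix_eq)

lemma \<phi>_add: "\<phi> (h + k) = \<phi> h + \<phi> k"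
  unfolding filter_matrix_eq_iff
  by (simp add: \<Phi>_filter \<Phi>_add matrix_vector_mult_add_rdistrib distrib_right poly_mod_add_left)

lemma \<phi>_mult: "\<phi> (h * k) = \<phi> h ** \<phi> k"
  unfolding filter_matrix_eq_iff
  by (simp add: \<Phi>_filter mod_mult_right_eq mult.assoc flip: matrix_vector_mul_assoc)

lemma \<phi>_const: "\<phi> [:c:] = mat c"
  unfolding filter_matrix_eq_iff by (simp add: \<Phi>_filter \<Phi>_smult mod_smult_left \<Phi>_mod)

lemma \<phi>_eqI: "(\<And>z. poly p z = 0 \<Longrightarrow> poly h z = poly k z) \<Longrightarrow> \<phi> h = \<phi> k"
  using mod_eq_iff_eq_on_zeros[OF separable, of h k]
  unfolding filter_matrix_eq_iff by (metis \<Phi>_filter mod_mult_left_eq)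

lemma \<phi>_mod: "\<phi> (h mod p) = \<phi> h"
  by (rule \<phi>_eqI) (simp add: poly_mod_at_zero)

lemma \<phi>_pcompose_pCons: "\<phi> (pcompose (pCons a f) r) = mat a + \<phi> r ** \<phi> (pcompose f r)"
  by (simp add: pcompose_pCons \<phi>_add \<phi>_mult \<phi>_const)

lemma \<phi>_0: "\<phi> 0 = 0"
  using \<phi>_const[of 0] by simp

lemma \<phi>_pcompose: "\<phi> (pcompose f r) = matrix_poly f (\<phi> r)"
  by (induction f) (simp_all add: \<phi>_0 matrix_poly_0 matrix_poly_pCons \<phi>_pcompose_pCons)

text \<open>The eigenvector for the zero \<open>z\<close> is the coordinate vector of \<open>p / (x - z)\<close>.\<close>

lemma ex_common_eigenvector:
  assumes z: "poly p z = 0"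
  shows "\<exists>v. v \<noteq> 0 \<and> (\<forall>h. \<phi> h *v v = poly h z *s v)"
proof -
  obtain e where e: "p = [:- z, 1:] * e"
    using z by (metis dvd_def poly_eq_0_iff_dvd)
  have p0: "p \<noteq> 0" using separable by (auto simp: rsquarefree_def)
  then have e0: "e \<noteq> 0" using e by auto
  have "degree p = Suc (degree e)" using e0 unfolding e by (subst degree_mult_eq) auto
  then have emod: "e mod p = e" by (simp add: mod_poly_less)
  define v where "v = inv \<Phi> e"
  have v: "\<Phi> v = e" using emod by (simp add: v_def \<Phi>_inv)
  have "\<phi> h *v v = poly h z *s v" for h
  proof -
    \<comment> \<open>\<open>h\<close> and the constant \<open>poly h z\<close> differ by a multiple
      of \<open>x - z\<close>; times \<open>e\<close> this becomes a multiple of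
      \<open>p\<close>.\<close>
    have "[:- z, 1:] dvd h - [:poly h z:]" by (simp flip: poly_eq_0_iff_dvd)
    then have "p dvd (h - [:poly h z:]) * e" unfolding e by (rule mult_dvd_mono) simp
    then have "p dvd h * e - smult (poly h z) e" by (simp add: left_diff_distrib)
    then have "h * e mod p = smult (poly h z) e mod p" by (simp add: mod_eq_dvd_iff)
    then have "\<Phi> (\<phi> h *v v) = \<Phi> (poly h z *s v)"
      by (simp add: \<Phi>_filter \<Phi>_smult v mod_smult_left emod)
    then show ?thesis by (simp add: inj_\<Phi>)
  qed
  moreover have "v \<noteq> 0" using v e0 \<Phi>_smult[of 0 0] by auto
  ultimately show ?thesis by blast
qed

section \<open>Eigenvectors of the shift in invariant subspaces\<close>

lemma pcompose_eigenvector: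
  "\<phi> r *v v = c *s v \<Longrightarrow> \<phi> (pcompose f r) *v v = poly f c *s v"
  by (induction f)
     (simp_all add: \<phi>_0 \<phi>_pcompose_pCons matrix_vector_mult_add_rdistrib vector_mult_smult
       vector_smult_assoc mult.commute vector_sadd_rdistrib flip: matrix_vector_mul_assoc)

text \<open>Factors are stripped one at a time: if \<open>r - c\<close> kills \<open>w\<close>, then
  \<open>w\<close> is an eigenvector; otherwise its image is a nonzero vector of \<open>W\<close>
  killed by the remaining product.\<close>

lemma ex_eigenvector_of_prod:
  assumes W: "vec.subspace W" "\<forall>v\<in>W. \<phi> r *v v \<in> W"
    and "finite S" and "w \<in> W" "w \<noteq> 0" "\<phi> (\<Prod>c\<in>S. r - [:c:]) *v w = 0"
  shows "\<exists>v\<in>W. v \<noteq> 0 \<and> (\<exists>c. \<phi> r *v v = c *s v)"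
  using assms(3-6)
proof (induction S arbitrary: w)
  case empty
  \<comment> \<open>The empty product acts as the identity, which contradicts
    \<open>w \<noteq> 0\<close>.\<close>
  then show ?case using \<phi>_const[of 1] by (simp add: one_pCons)
next
  case (insert c S)
  have r: "r - [:c:] = r + [:- c:]" by simp
  define u where "u = \<phi> (r - [:c:]) *v w"
  have u: "u = \<phi> r *v w - c *s w"
    unfolding u_def r \<phi>_add \<phi>_const by (simp add: matrix_vector_mult_add_rdistrib vec_eq_iff)
  show ?case
  proof (cases "u = 0")
    case True
    then show ?thesis using u insert by auto
  next
    case False
    have "(\<Prod>c\<in>insert c S. r - [:c:]) = (\<Prod>c\<in>S. r - [:c:]) * (r - [:c:])"
      using insert by (simp add: mult.commute)
    then have "\<phi> (\<Prod>c\<in>S. r - [:c:]) *v u = 0"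
      using insert.prems unfolding u_def by (simp add: \<phi>_mult flip: matrix_vector_mul_assoc)
    moreover have "u \<in> W"
      unfolding u using W insert.prems by (simp add: vec.subspace_diff vec.subspace_scale)
    ultimately show ?thesis using insert.IH False by blast
  qed
qed

text \<open>The product of \<open>r - c\<close> over the values \<open>c\<close> of \<open>r\<close>
  at the zeros of \<open>p\<close> vanishes at every zero, so it acts as zero on all of
  \<open>W\<close>.\<close>

lemma ex_eigenvector_in_invariant_subspace:
  assumes W: "vec.subspace W" "\<forall>v\<in>W. \<phi> r *v v \<in> W" and "W \<noteq> {0}"
  shows "\<exists>v\<in>W. v \<noteq> 0 \<and> (\<exists>c. \<phi> r *v v = c *s v)"
proof -
  define S where "S = poly r ` {z. poly p z = 0}"
  have S: "finite S"
    using separable by (auto simp: S_def rsquarefree_def poly_roots_finite)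
  obtain w where w: "w \<in> W" "w \<noteq> 0" using assms(3) vec.subspace_0[OF W(1)] by blast
  have "\<phi> (\<Prod>c\<in>S. r - [:c:]) = \<phi> 0"
    by (rule \<phi>_eqI) (use S in \<open>auto simp: poly_prod S_def\<close>)
  then have "\<phi> (\<Prod>c\<in>S. r - [:c:]) *v w = 0" by (simp add: \<phi>_0)
  then show ?thesis using ex_eigenvector_of_prod W S w by blast
qed

text \<open>The adjoint is a polynomial in \<open>\<phi> r\<close>, so it keeps the eigenvectors of
  \<open>\<phi> r\<close>.\<close>

lemma ex_unitary_diagonalizing:
  assumes "adjoint_matrix (\<phi> r) = matrix_poly q (\<phi> r)"
  shows "\<exists>F. unitary_matrix F \<and> diagonalizes F (\<phi> r)"
proof (rule ex_unitary_diagonalization)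
  show "\<forall>v c. \<phi> r *v v = c *s v \<longrightarrow> (\<exists>d. adjoint_matrix (\<phi> r) *v v = d *s v)"
    using pcompose_eigenvector \<phi>_pcompose assms by metis
qed (use ex_eigenvector_in_invariant_subspace in blast)

section \<open>Fourier transforms and the diagonal entries they produce\<close>

lemma diagonalizes_\<phi>_pcompose:
  assumes F: "invertible F" and r: "diagonalizes F (\<phi> r)"
  shows "diagonalizes F (\<phi> (pcompose f r))"
proof (induction f)
  case 0
  then show ?case using diagonalizes_mat[OF F, of 0] by (simp add: \<phi>_0)
next
  case (pCons a f)
  then show ?case
    using F r by (simp add: \<phi>_pcompose_pCons diagonalizes_add diagonalizes_mult diagonalizes_mat)
qed

lemma fourier_transform_iff:
  assumes r: "r \<in> residue_polys p"
  shows "fourier_transform (generated_algebra p r) p \<Phi> F \<longleftrightarrow> invertible F \<and> diagonalizes F (\<phi> r)"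
proof -
  have "diagonalizes F (\<phi> r)" if "\<forall>h\<in>generated_algebra p r. diagonalizes F (\<phi> h)"
    using that by (simp add: generated_algebra_def)
  moreover have "diagonalizes F (\<phi> h)"
    if "invertible F" "diagonalizes F (\<phi> r)" "h \<in> generated_algebra p r" for h
    using that diagonalizes_\<phi>_pcompose by (auto simp: generated_algebra_eq_range[OF r] \<phi>_mod)
  ultimately show ?thesis
    unfolding fourier_transform_def diagonalizes_def[symmetric] by blast
qed

text \<open>\<open>F *v v\<close> is an eigenvector of a diagonal matrix, so any nonzero coordinate
  \<open>i\<close> of it reads off the eigenvalue. As \<open>v\<close> is common to all
  \<open>h\<close>, one \<open>i\<close> serves \<open>r\<close> and \<open>pcompose g r\<close> at
  once.\<close>

lemma ex_diagonal_entry_eq: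
  assumes F: "invertible F" and z: "poly p z = 0"
  shows "\<exists>i. \<forall>h. diagonalizes F (\<phi> h) \<longrightarrow> (F ** \<phi> h ** matrix_inv F) $ i $ i = poly h z"
proof -
  obtain v where v: "v \<noteq> 0" "\<And>h. \<phi> h *v v = poly h z *s v"
    using ex_common_eigenvector[OF z] by blast
  have FF: "matrix_inv F *v (F *v v) = v"
    using F by (simp add: matrix_vector_mul_assoc matrix_inv_cancel)
  then have "F *v v \<noteq> 0" using v(1) by auto
  then obtain i where i: "(F *v v) $ i \<noteq> 0" by (auto simp: vec_eq_iff)
  have "(F ** \<phi> h ** matrix_inv F) $ i $ i = poly h z" if "diagonalizes F (\<phi> h)" for h
  proof -
    have "(F ** \<phi> h ** matrix_inv F) *v (F *v v) = poly h z *s (F *v v)"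
      using FF by (simp add: v vector_mult_smult flip: matrix_vector_mul_assoc)
    then have "((F ** \<phi> h ** matrix_inv F) *v (F *v v)) $ i = poly h z * (F *v v) $ i" by simp
    then show ?thesis
      using i diagonal_matrix_vector_component[OF that[unfolded diagonalizes_def]] by simp
  qed
  then show ?thesis by blast
qed

text \<open>Stated for arbitrary \<open>g\<close> because it is applied to \<open>1 - x\<close> in
  the positive definite case and to \<open>(1 - x) (1 - q)\<close> otherwise.\<close>

lemma diagonalizes_pcompose_imp_iff_inj_on:
  assumes ex: "\<exists>F. unitary_matrix F \<and> diagonalizes F (\<phi> r)"
  shows "(\<forall>F. unitary_matrix F \<and> diagonalizes F (\<phi> (pcompose g r)) \<longrightarrow> diagonalizes F (\<phi> r)) \<longleftrightarrow>
    inj_on (poly g) (poly r ` {z. poly p z = 0})" (is "?conv \<longleftrightarrow> ?inj")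
proof
  assume conv: ?conv
  obtain F where F: "unitary_matrix F" "diagonalizes F (\<phi> r)" using ex by blast
  have inv: "invertible F" using F(1) by (rule unitary_matrix_invertible)
  have gr: "diagonalizes F (\<phi> (pcompose g r))" using inv F(2) by (rule diagonalizes_\<phi>_pcompose)
  show ?inj
  proof (rule inj_onI)
    fix x y assume "x \<in> poly r ` {z. poly p z = 0}" "y \<in> poly r ` {z. poly p z = 0}"
      and eq: "poly g x = poly g y"
    then obtain z w where zw: "poly p z = 0" "x = poly r z" "poly p w = 0" "y = poly r w" by blast
    obtain i where i: "\<And>h. diagonalizes F (\<phi> h) \<Longrightarrow> (F ** \<phi> h ** matrix_inv F) $ i $ i = poly h z"
      using ex_diagonal_entry_eq[OF inv zw(1)] by blast
    obtain j where j: "\<And>h. diagonalizes F (\<phi> h) \<Longrightarrow> (F ** \<phi> h ** matrix_inv F) $ j $ j = poly h w"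
      using ex_diagonal_entry_eq[OF inv zw(3)] by blast
    have "\<not> (\<exists>G. unitary_matrix G \<and> diagonalizes G (\<phi> (pcompose g r)) \<and> \<not> diagonalizes G (\<phi> r))"
      using conv by blast
    then have "\<not> ((F ** \<phi> (pcompose g r) ** matrix_inv F) $ i $ i = (F ** \<phi> (pcompose g r) ** matrix_inv F) $ j $ j
        \<and> (F ** \<phi> r ** matrix_inv F) $ i $ i \<noteq> (F ** \<phi> r ** matrix_inv F) $ j $ j)"
      using ex_unitary_not_diagonalizing[OF F(1) gr F(2)] by blast
    then show "x = y"
      using i[OF gr] j[OF gr] i[OF F(2)] j[OF F(2)] eq zw by (simp add: poly_pcompose)
  qed
next
  assume ?inj
  moreover have "finite (poly r ` {z. poly p z = 0})"
    using separable by (auto simp: rsquarefree_def poly_roots_finite)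
  ultimately obtain f where f: "\<forall>y\<in>poly r ` {z. poly p z = 0}. poly f (poly g y) = y"
    using ex_poly_left_inverse_iff by blast
  have "\<phi> (pcompose f (pcompose g r)) = \<phi> r"
    by (rule \<phi>_eqI) (use f in \<open>simp add: poly_pcompose\<close>)
  then show ?conv
    using diagonalizes_\<phi>_pcompose[of _ "pcompose g r" f] unitary_matrix_invertible by metis
qed

end

section \<open>Covariance of a Gauss-Markov random field\<close>

lemma gaussian_variable_square_integrable:
  assumes "prob_space M" "gaussian_variable M X"
  shows "integrable M (\<lambda>\<omega>. (X \<omega>)\<^sup>2)"
proof -
  interpret prob_space M by fact
  have X [measurable]: "X \<in> borel_measurable M"
    using assms(2) by (simp add: gaussian_variable_def)
  obtain \<mu> where \<mu>: "(AE \<omega> in M. X \<omega> = \<mu>) \<or> (\<exists>\<tau>>0. distributed M lborel X (normal_density \<mu> \<tau>))"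
    using assms(2) by (auto simp: gaussian_variable_def)
  then show ?thesis
  proof
    assume "AE \<omega> in M. X \<omega> = \<mu>"
    then have "integrable M (\<lambda>\<omega>. (X \<omega>)\<^sup>2) \<longleftrightarrow> integrable M (\<lambda>\<omega>. \<mu>\<^sup>2)"
      by (intro integrable_cong_AE) auto
    then show ?thesis by simp
  next
    assume "\<exists>\<tau>>0. distributed M lborel X (normal_density \<mu> \<tau>)"
    then obtain \<tau> where \<tau>: "\<tau> > 0" "distributed M lborel X (normal_density \<mu> \<tau>)" by blast
    have moment: "integrable M (\<lambda>\<omega>. (X \<omega> - \<mu>) ^ k)" for k
      using integrable_normal_moment[OF \<tau>(1), of \<mu> k]
        distributed_integrable[OF \<tau>(2), of "\<lambda>x. (x - \<mu>) ^ k"] by simp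
    \<comment> \<open>The square of \<open>X\<close> is expanded around \<open>\<mu>\<close>; the
      exponent 1 is kept so that \<open>moment\<close> applies.\<close>
    have "integrable M (\<lambda>\<omega>. (X \<omega> - \<mu>) ^ 2 + 2 * \<mu> * (X \<omega> - \<mu>) ^ 1 + \<mu>\<^sup>2)"
      by (intro Bochner_Integration.integrable_add integrable_mult_right moment) simp
    then show ?thesis by (simp add: power2_eq_square algebra_simps)
  qed
qed

lemma integrable_mult_of_square_integrable:
  fixes X Y :: "'w \<Rightarrow> real"
  assumes [measurable]: "X \<in> borel_measurable M" "Y \<in> borel_measurable M"
    and "integrable M (\<lambda>\<omega>. (X \<omega>)\<^sup>2)" "integrable M (\<lambda>\<omega>. (Y \<omega>)\<^sup>2)"
  shows "integrable M (\<lambda>\<omega>. X \<omega> * Y \<omega>)"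
proof (rule Bochner_Integration.integrable_bound[OF Bochner_Integration.integrable_add[OF assms(3,4)]])
  have "\<bar>x * y\<bar> \<le> x\<^sup>2 + y\<^sup>2" for x y :: real
    using sum_squares_bound[of "\<bar>x\<bar>" "\<bar>y\<bar>"] abs_ge_zero[of "x * y"]
    unfolding abs_mult power2_abs by linarith
  then show "AE \<omega> in M. norm (X \<omega> * Y \<omega>) \<le> norm ((X \<omega>)\<^sup>2 + (Y \<omega>)\<^sup>2)" by simp
qed measurable

lemma gaussian_vector_integrable:
  assumes M: "prob_space M" and X: "gaussian_vector M X"
  shows "integrable M (\<lambda>\<omega>. X \<omega> $ i)" "integrable M (\<lambda>\<omega>. X \<omega> $ i * X \<omega> $ j)"
proof -
  interpret prob_space M by fact
  have X: "gaussian_variable M (\<lambda>\<omega>. X \<omega> $ k)" for k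
    using X[unfolded gaussian_vector_def, rule_format, of "axis k 1"] by (simp add: inner_axis')
  then have meas: "(\<lambda>\<omega>. X \<omega> $ k) \<in> borel_measurable M" for k
    by (simp add: gaussian_variable_def)
  show "integrable M (\<lambda>\<omega>. X \<omega> $ i * X \<omega> $ j)"
    by (intro integrable_mult_of_square_integrable meas gaussian_variable_square_integrable[OF M X])
  \<comment> \<open>A coordinate is its product with the constant 1, which is square integrable on a
    probability space.\<close>
  show "integrable M (\<lambda>\<omega>. X \<omega> $ i)"
    using integrable_mult_of_square_integrable[OF meas[of i], of "\<lambda>_. 1"]
      gaussian_variable_square_integrable[OF M X] by simp
qed

text \<open>Zero mean removes the centering, and integrability of the products lets the expectation
  pass through the double sum.\<close>

lemma covariance_matrix_linear_image:
  assumes s: "\<And>\<omega>. \<omega> \<in> space M \<Longrightarrow> s \<omega> = B *v \<nu> \<omega>"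
    and int: "\<And>i. integrable M (\<lambda>\<omega>. \<nu> \<omega> $ i)" "\<And>i j. integrable M (\<lambda>\<omega>. \<nu> \<omega> $ i * \<nu> \<omega> $ j)"
    and mean: "mean_vector M \<nu> = 0"
  shows "covariance_matrix M s = B ** covariance_matrix M \<nu> ** transpose B"
proof -
  have s': "s \<omega> $ i = (\<Sum>k\<in>UNIV. B $ i $ k * \<nu> \<omega> $ k)" if "\<omega> \<in> space M" for \<omega> i
    using s[OF that] by (simp add: matrix_vector_mult_def)
  have zero: "(\<integral>\<omega>. \<nu> \<omega> $ k \<partial>M) = 0" for k
    using mean by (simp add: mean_vector_def vec_eq_iff)
  have "(\<integral>\<omega>. s \<omega> $ i \<partial>M) = (\<integral>\<omega>. (\<Sum>k\<in>UNIV. B $ i $ k * \<nu> \<omega> $ k) \<partial>M)" for i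
    by (rule Bochner_Integration.integral_cong) (simp_all add: s')
  then have means: "mean_vector M s = 0"
    by (simp add: mean_vector_def vec_eq_iff zero int)
  have "covariance_matrix M s $ i $ j = (B ** covariance_matrix M \<nu> ** transpose B) $ i $ j" for i j
  proof -
    have "covariance_matrix M s $ i $ j
        = (\<integral>\<omega>. (\<Sum>l\<in>UNIV. \<Sum>k\<in>UNIV. B $ i $ k * B $ j $ l * (\<nu> \<omega> $ k * \<nu> \<omega> $ l)) \<partial>M)"
      unfolding covariance_matrix_def means vec_lambda_beta
      by (rule Bochner_Integration.integral_cong)
         (simp_all add: s' sum_product mult_ac, subst sum.swap, simp add: mult_ac)
    also have "\<dots> = (\<Sum>l\<in>UNIV. \<Sum>k\<in>UNIV. B $ i $ k * B $ j $ l * covariance_matrix M \<nu> $ k $ l)"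
      by (simp add: int mean covariance_matrix_def)
    also have "\<dots> = (B ** covariance_matrix M \<nu> ** transpose B) $ i $ j"
      by (simp add: matrix_matrix_mult_def transpose_def sum_distrib_left sum_distrib_right mult_ac)
    finally show ?thesis .
  qed
  then show ?thesis by (simp add: vec_eq_iff)
qed

text \<open>A minimizer of the quadratic form on the unit sphere is an eigenvector for the minimum.\<close>

lemma ex_negative_eigenvalue:
  fixes P :: "real ^ 'n ^ 'n"
  assumes sym: "transpose P = P" and inv: "invertible P" and npd: "\<not> positive_definite P"
  shows "\<exists>c<0. eigenvalue P c"
proof -
  have adj: "x \<bullet> (P *v y) = (P *v x) \<bullet> y" for x y
    using dot_lmul_matrix[of x P y] transpose_matrix_vector[of P x] sym by simp
  obtain v0 where v0: "v0 \<noteq> 0" "v0 \<bullet> (P *v v0) \<le> 0"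
    using npd sym by (auto simp: positive_definite_def not_less)
  have "continuous_on (sphere 0 1) (\<lambda>v. v \<bullet> (P *v v))"
    by (intro continuous_intros matrix_vector_mult_linear_continuous_on)
  moreover have "sphere (0 :: real ^ 'n) 1 \<noteq> {}" by simp
  ultimately obtain u where "u \<in> sphere 0 1" "\<forall>v\<in>sphere 0 1. u \<bullet> (P *v u) \<le> v \<bullet> (P *v v)"
    using continuous_attains_inf[OF compact_sphere] by blast
  then have u: "norm u = 1" "\<And>v. norm v = 1 \<Longrightarrow> u \<bullet> (P *v u) \<le> v \<bullet> (P *v v)" by auto
  define \<mu> where "\<mu> = u \<bullet> (P *v u)"
  \<comment> \<open>By homogeneity the minimum on the sphere bounds the form everywhere.\<close>
  have min: "\<mu> * (v \<bullet> v) \<le> v \<bullet> (P *v v)" for v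
  proof (cases "v = 0")
    case False
    then have "\<mu> \<le> (v /\<^sub>R norm v) \<bullet> (P *v (v /\<^sub>R norm v))"
      unfolding \<mu>_def by (intro u(2)) simp
    also have "\<dots> = (v \<bullet> (P *v v)) / (norm v)\<^sup>2"
      by (simp add: matrix_vector_mult_scaleR power2_eq_square divide_inverse)
    finally show ?thesis
      using False by (simp add: pos_le_divide_eq power2_norm_eq_inner)
  qed simp
  \<comment> \<open>\<open>y\<close> is half the gradient at \<open>u\<close> of the form minus
    \<open>\<mu>\<close> times the squared norm. This difference is nonnegative and zero at
    \<open>u\<close>, but a small step against \<open>y \<noteq> 0\<close> would make it
    negative.\<close>
  define y where "y = P *v u - \<mu> *\<^sub>R u"
  define k where "k = y \<bullet> (P *v y) - \<mu> * (y \<bullet> y)"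
  have "y = 0"
  proof (rule ccontr)
    assume "y \<noteq> 0"
    then have y: "y \<bullet> y > 0" by simp
    have uu: "u \<bullet> u = 1" using u(1) by (simp add: dot_square_norm)
    have uy: "(P *v u) \<bullet> y = y \<bullet> y + \<mu> * (u \<bullet> y)"
      by (simp add: y_def inner_diff_left)
    have "0 \<le> - 2 * t * (y \<bullet> y) + t\<^sup>2 * k" for t
    proof -
      have "(u - t *\<^sub>R y) \<bullet> (P *v (u - t *\<^sub>R y)) - \<mu> * ((u - t *\<^sub>R y) \<bullet> (u - t *\<^sub>R y))
          = - 2 * t * (y \<bullet> y) + t\<^sup>2 * k"
        using adj[of u y] adj[of u u] uy uu inner_commute[of y "P *v u"] inner_commute[of y u]
        by (simp add: k_def matrix_vector_mult_diff_distrib matrix_vector_mult_scaleR inner_diff_left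
            inner_diff_right power2_eq_square \<mu>_def) (simp add: algebra_simps)
      then show ?thesis using min[of "u - t *\<^sub>R y"] by linarith
    qed
    then have *: "2 * t * (y \<bullet> y) \<le> t * (t * k)" for t
      by (metis (no_types) power2_eq_square mult.assoc add.commute add_0 diff_ge_0_iff_ge minus_mult_left
          uminus_add_conv_diff)
    \<comment> \<open>Small enough that the quadratic term \<open>t\<^sup>2 * k\<close> is at most
      \<open>t * (y \<bullet> y)\<close>; the added 1 keeps the denominator positive.\<close>
    define t where "t = (y \<bullet> y) / (\<bar>k\<bar> + 1)"
    have t: "t > 0" using y by (simp add: t_def)
    have "t * k \<le> t * (\<bar>k\<bar> + 1)" using t by (intro mult_left_mono) auto
    also have "\<dots> = y \<bullet> y" by (simp add: t_def)
    finally have "t * (t * k) \<le> t * (y \<bullet> y)" using t by simp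
    then have "t * (y \<bullet> y) \<le> 0" using *[of t] by simp
    then show False using t y by (simp add: mult_le_0_iff)
  qed
  then have Pu: "P *v u = \<mu> *s u" by (simp add: y_def scalar_mult_eq_scaleR)
  have "u \<noteq> 0" using u(1) by auto
  \<comment> \<open>Invertibility excludes \<open>\<mu> = 0\<close>, and \<open>v0\<close> excludes
    \<open>\<mu> > 0\<close>.\<close>
  then have "P *v u \<noteq> 0" using inv matrix_left_invertible_ker invertible_left_inverse by blast
  then have "\<mu> \<noteq> 0" using Pu by auto
  moreover have "\<mu> \<le> 0"
  proof -
    have "\<mu> * (v0 \<bullet> v0) \<le> 0" using min[of v0] v0(2) by linarith
    then show ?thesis using v0(1) by (metis inner_gt_zero_iff mult_le_0_iff not_le)
  qed
  ultimately show ?thesis using Pu \<open>u \<noteq> 0\<close> by (auto simp: eigenvalue_def intro!: exI[of _ \<mu>])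
qed

text \<open>Write \<open>v = a + i b\<close> with real \<open>a\<close> and \<open>b\<close>.
  Symmetry forces \<open>Im \<kappa> = 0\<close>, so a nonzero one among \<open>a\<close> and
  \<open>b\<close> is a real eigenvector for \<open>Re \<kappa>\<close>, which is positive by
  definiteness.\<close>

lemma positive_definite_complex_eigenvalue:
  assumes P: "positive_definite P" and v: "v \<noteq> 0" "complex_matrix P *v v = \<kappa> *s v"
  shows "\<exists>k>0. \<kappa> = complex_of_real k"
proof -
  define a b where "a = (\<chi> i. Re (v $ i))" and "b = (\<chi> i. Im (v $ i))"
  have comp: "(\<Sum>j\<in>UNIV. complex_of_real (P $ i $ j) * v $ j) = \<kappa> * v $ i" for i
    using v(2) by (simp add: vec_eq_iff matrix_vector_mult_def)
  have a: "P *v a = Re \<kappa> *\<^sub>R a - Im \<kappa> *\<^sub>R b"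
    using arg_cong[OF comp, of Re] by (simp add: vec_eq_iff matrix_vector_mult_def a_def b_def Re_sum)
  have b: "P *v b = Re \<kappa> *\<^sub>R b + Im \<kappa> *\<^sub>R a"
    using arg_cong[OF comp, of Im] by (simp add: vec_eq_iff matrix_vector_mult_def a_def b_def Im_sum)
  have ab: "a \<noteq> 0 \<or> b \<noteq> 0"
    using v(1) by (auto simp: a_def b_def vec_eq_iff complex_eq_iff)
  have pos: "x \<bullet> (P *v x) > 0" if "x \<noteq> 0" for x
    using P that by (simp add: positive_definite_def)
  have "b \<bullet> (P *v a) = a \<bullet> (P *v b)"
    using P dot_lmul_matrix[of b P a] transpose_matrix_vector[of P b]
    by (simp add: positive_definite_def inner_commute)
  then have "Im \<kappa> * (a \<bullet> a + b \<bullet> b) = 0"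
    by (simp add: a b inner_diff_right inner_add_right inner_commute algebra_simps)
  moreover have "a \<bullet> a + b \<bullet> b > 0"
    using ab by (metis add_nonneg_pos add_pos_nonneg inner_ge_zero inner_gt_zero_iff)
  ultimately have im: "Im \<kappa> = 0" by simp
  have "Re \<kappa> > 0"
    using ab
  proof
    assume "a \<noteq> 0"
    then show ?thesis using pos[of a] a im by (simp add: zero_less_mult_iff inner_ge_zero[THEN leD])
  next
    assume "b \<noteq> 0"
    then show ?thesis using pos[of b] b im by (simp add: zero_less_mult_iff inner_ge_zero[THEN leD])
  qed
  then show ?thesis using im by (auto simp: complex_eq_iff intro!: exI[of _ "Re \<kappa>"])
qed

text \<open>With \<open>B\<close> the inverse of \<open>P = mat 1 - A\<close>, the covariance of
  \<open>s\<close> is \<open>B ** C ** transpose B\<close> for the noise covariance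
  \<open>C\<close>. The product form of the result is the one that transfers
  diagonalization.\<close>

lemma gmrf_covariance:
  fixes A :: "real ^ 'n ^ 'n"
  assumes gmrf: "gmrf M \<sigma> A s" and normal: "A ** transpose A = transpose A ** A"
  shows "(if transpose A = A \<and> positive_definite (mat 1 - A) then mat 1 - A
          else (mat 1 - A) ** (mat 1 - transpose A)) ** covariance_matrix M s = mat (\<sigma>\<^sup>2)"
proof -
  define P B where "P = mat 1 - A" and "B = matrix_inv P"
  have Pt: "transpose P = mat 1 - transpose A" by (simp add: P_def vec_eq_iff transpose_def mat_def)
  obtain \<nu> where M: "prob_space M" and inv: "invertible P"
    and \<nu>: "\<And>\<omega>. \<omega> \<in> space M \<Longrightarrow> P *v s \<omega> = \<nu> \<omega>" "gaussian_vector M \<nu>" "mean_vector M \<nu> = 0"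
    and cov1: "transpose A = A \<Longrightarrow> positive_definite P \<Longrightarrow> covariance_matrix M \<nu> = \<sigma>\<^sup>2 *\<^sub>R P"
    and cov2: "transpose A = A \<Longrightarrow> \<exists>c<0. eigenvalue P c \<Longrightarrow> covariance_matrix M \<nu> = \<sigma>\<^sup>2 *\<^sub>R mat 1"
    and cov3: "transpose A \<noteq> A \<Longrightarrow> covariance_matrix M \<nu> = \<sigma>\<^sup>2 *\<^sub>R mat 1"
    using gmrf unfolding gmrf_def P_def by blast
  have PB: "P ** B = mat 1" "B ** P = mat 1" using inv by (simp_all add: B_def matrix_inv_cancel)
  have "s \<omega> = B *v \<nu> \<omega>" if "\<omega> \<in> space M" for \<omega>
    using \<nu>(1)[OF that] PB(2) by (metis matrix_vector_mul_assoc matrix_vector_mul_lid)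
  then have cov: "covariance_matrix M s = B ** covariance_matrix M \<nu> ** transpose B"
    by (rule covariance_matrix_linear_image) (use gaussian_vector_integrable[OF M \<nu>(2)] \<nu>(3) in auto)
  have PBt: "transpose P ** transpose B = mat 1" using PB(2) by (simp flip: matrix_transpose_mul)
  have scaleR: "c *\<^sub>R X = mat c ** X" for c and X :: "real ^ 'n ^ 'n" by (simp add: vec_eq_iff)
  show ?thesis
  proof (cases "transpose A = A \<and> positive_definite P")
    case True
    then have "P ** covariance_matrix M s = P ** (B ** (P ** mat (\<sigma>\<^sup>2)) ** transpose B)"
      by (simp add: cov cov1 scaleR mat_mult_commute)
    also have "\<dots> = (P ** B) ** P ** (mat (\<sigma>\<^sup>2) ** transpose B)"
      by (simp only: matrix_mul_assoc)
    also have "\<dots> = (P ** transpose B) ** mat (\<sigma>\<^sup>2)"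
      by (simp add: PB mat_mult_commute matrix_mul_assoc)
    also have "\<dots> = mat (\<sigma>\<^sup>2)" using PBt True Pt by (simp add: P_def)
    finally show ?thesis using True by (simp add: P_def)
  next
    case False
    \<comment> \<open>A symmetric \<open>P\<close> that is invertible but not positive definite has
      a negative eigenvalue, so the noise is white in all remaining cases.\<close>
    have "covariance_matrix M \<nu> = \<sigma>\<^sup>2 *\<^sub>R mat 1"
    proof (cases "transpose A = A")
      case True
      then show ?thesis
        using cov2 False ex_negative_eigenvalue[OF _ inv] Pt by (simp add: P_def)
    qed (rule cov3)
    then have "covariance_matrix M s = B ** mat (\<sigma>\<^sup>2) ** transpose B"
      by (simp add: cov scaleR)
    also have "\<dots> = B ** transpose B ** mat (\<sigma>\<^sup>2)"
      by (metis mat_mult_commute matrix_mul_assoc)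
    finally have c: "covariance_matrix M s = B ** transpose B ** mat (\<sigma>\<^sup>2)" .
    \<comment> \<open>Normality swaps \<open>P\<close> and its transpose, which brings
      \<open>P\<close> next to \<open>B\<close>.\<close>
    have "P ** transpose P = transpose P ** P"
      unfolding Pt using normal
      by (simp add: P_def vec_eq_iff matrix_matrix_mult_def mat_def left_diff_distrib right_diff_distrib
          sum_subtractf if_distrib[of "\<lambda>x. x * _"] if_distrib[of "\<lambda>x. _ * x"] cong: if_cong)
    then have "P ** transpose P ** covariance_matrix M s
        = transpose P ** (P ** B) ** transpose B ** mat (\<sigma>\<^sup>2)"
      unfolding c by (simp only: matrix_mul_assoc)
    also have "\<dots> = mat (\<sigma>\<^sup>2)" by (simp add: PB PBt)
    finally show ?thesis using False by (auto simp: Pt simp flip: P_def)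
  qed
qed

text \<open>The values of \<open>r\<close> at the zeros of \<open>p\<close> are the eigenvalues of
  \<open>A\<close>. Injectivity is stated on them because the shift is \<open>r\<close> and the
  generator in question is \<open>g(r)\<close>; for the shift \<open>x\<close> they are the zeros
  themselves, which gives the last conjunct.\<close>

theorem theorem37:
  fixes A :: "real ^ 'n ^ 'n"
    and q p r :: "complex poly"
    and \<A> :: "complex poly set"
    and \<Phi> :: "complex ^ 'n \<Rightarrow> complex poly"
    and M :: "'w measure" and s :: "'w \<Rightarrow> real ^ 'n" and \<sigma> :: real
  defines "g \<equiv> [:1, - 1:] * (1 - q)"
  assumes normal: "A ** transpose A = transpose A ** A"
    and transpose_poly: "complex_matrix (transpose A) = matrix_poly q (complex_matrix A)"
    and model: "signal_model_with_shift \<A> p \<Phi> r (complex_matrix A)"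
  shows "(\<exists>F. unitary_matrix F \<and> fourier_transform \<A> p \<Phi> F) \<and>
    (gmrf M \<sigma> A s \<longrightarrow>
       (\<forall>F. unitary_matrix F \<and> fourier_transform \<A> p \<Phi> F \<longrightarrow> klt M s F) \<and>
       ((\<forall>F. klt M s F \<longrightarrow> unitary_matrix F \<and> fourier_transform \<A> p \<Phi> F) \<longleftrightarrow>
          generated_algebra p (pcompose g r mod p) = \<A>)) \<and>
    (generated_algebra p (pcompose g r mod p) = \<A> \<longleftrightarrow>
       inj_on (poly g) (poly r ` {z. poly p z = 0})) \<and>
    (r = [:0, 1:] mod p \<longrightarrow>
       (generated_algebra p (pcompose g r mod p) = \<A> \<longleftrightarrow>
          inj_on (poly g) {z. poly p z = 0}))"
proof -
  have r: "r \<in> residue_polys p" and \<A>: "\<A> = generated_algebra p r"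
    and A: "filter_matrix p \<Phi> r = complex_matrix A"
    using model by (auto simp: signal_model_with_shift_def)
  interpret polynomial_module p \<Phi>
    by (rule polynomial_module.intro)
       (use model in \<open>simp_all add: signal_model_with_shift_def signal_model_def\<close>)
  define \<Lambda> where "\<Lambda> = poly r ` {z. poly p z = 0}"
  have At: "\<phi> (pcompose q r) = complex_matrix (transpose A)"
    using transpose_poly by (simp add: \<phi>_pcompose A)
  have one_minus: "\<phi> (1 - h) = mat 1 - \<phi> h" for h
  proof -
    have "\<phi> (1 - h) + \<phi> h = mat 1" using \<phi>_const[of 1] by (simp add: one_pCons flip: \<phi>_add)
    then show ?thesis by (simp add: eq_diff_eq)
  qed
  have r1: "pcompose [:1, - 1:] r = 1 - r" by (simp add: pcompose_pCons one_pCons)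
  have "pcompose g r = (1 - r) * (1 - pcompose q r)"
    unfolding g_def pcompose_mult r1 pcompose_diff pcompose_1 ..
  then have gr: "\<phi> (pcompose g r) = complex_matrix ((mat 1 - A) ** (mat 1 - transpose A))"
    by (simp add: \<phi>_mult one_minus A At complex_matrix_mult complex_matrix_diff)
  have ft: "unitary_matrix F \<and> fourier_transform \<A> p \<Phi> F \<longleftrightarrow> unitary_matrix F \<and> diagonalizes F (\<phi> r)" for F
    unfolding \<A> fourier_transform_iff[OF r] using unitary_matrix_invertible by blast
  \<comment> \<open>\<open>A\<close> is real, so its adjoint is its transpose.\<close>
  have "adjoint_matrix (\<phi> r) = matrix_poly q (\<phi> r)"
    unfolding A transpose_poly[symmetric] by (simp add: vec_eq_iff transpose_def)
  then have ex: "\<exists>F. unitary_matrix F \<and> diagonalizes F (\<phi> r)" by (rule ex_unitary_diagonalizing)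
  have gen: "generated_algebra p (pcompose g r mod p) = \<A> \<longleftrightarrow> inj_on (poly g) \<Lambda>"
    unfolding \<A> \<Lambda>_def by (rule generated_algebra_pcompose_eq_iff[OF separable r])
  have field: "(\<forall>F. unitary_matrix F \<and> diagonalizes F (\<phi> r) \<longrightarrow> klt M s F) \<and>
      ((\<forall>F. klt M s F \<longrightarrow> unitary_matrix F \<and> diagonalizes F (\<phi> r)) \<longleftrightarrow> inj_on (poly g) \<Lambda>)"
    if gmrf: "gmrf M \<sigma> A s"
  proof -
    define pd where "pd \<longleftrightarrow> transpose A = A \<and> positive_definite (mat 1 - A)"
    \<comment> \<open>\<open>k\<close> is chosen so that \<open>\<phi> (pcompose k r)\<close> is
      \<open>\<sigma>\<^sup>2\<close> times the inverse of the covariance.\<close>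
    define k where "k = (if pd then [:1, - 1:] else g)"
    have "\<phi> (pcompose k r) = complex_matrix
        (if pd then mat 1 - A else (mat 1 - A) ** (mat 1 - transpose A))"
      by (simp add: k_def gr r1 one_minus A complex_matrix_diff)
    then have "\<phi> (pcompose k r) ** complex_matrix (covariance_matrix M s) = mat (complex_of_real (\<sigma>\<^sup>2))"
      using gmrf_covariance[OF gmrf normal] unfolding pd_def
      by (simp only: complex_matrix_mult[symmetric] complex_matrix_mat)
    moreover have "complex_of_real (\<sigma>\<^sup>2) \<noteq> 0" using gmrf by (simp add: gmrf_def)
    ultimately have klt: "klt M s F \<longleftrightarrow> unitary_matrix F \<and> diagonalizes F (\<phi> (pcompose k r))" for F
      unfolding klt_def diagonalizes_def[symmetric]
      using diagonalizes_iff_of_mult_eq_mat unitary_matrix_invertible by blast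
    have inj: "inj_on (poly k) \<Lambda> \<longleftrightarrow> inj_on (poly g) \<Lambda>"
    proof (cases pd)
      case True
      have eig: "\<exists>c>0. 1 - y = complex_of_real c \<and> poly q y = y" if y: "y \<in> \<Lambda>" for y
      proof -
        obtain z where z: "poly p z = 0" "y = poly r z" using y by (auto simp: \<Lambda>_def)
        obtain v where v: "v \<noteq> 0" "\<And>h. \<phi> h *v v = poly h z *s v"
          using ex_common_eigenvector[OF z(1)] by blast
        have "complex_matrix (mat 1 - A) *v v = (1 - y) *s v"
          using v(2)[of "1 - r"] by (simp add: one_minus A z(2) complex_matrix_diff)
        then obtain c where c: "c > 0" "1 - y = complex_of_real c"
          using positive_definite_complex_eigenvalue v(1) True unfolding pd_def by blast
        \<comment> \<open>For symmetric \<open>A\<close> one has \<open>q(A) = A\<close>; comparing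
          the eigenvalues at \<open>v\<close> shows that \<open>q\<close> fixes
          \<open>y\<close>.\<close>
        have "poly q y = y"
          using v(2)[of "pcompose q r"] v(2)[of r] v(1) True
          by (auto simp: At A pd_def poly_pcompose z(2))
        then show ?thesis using c by blast
      qed
      have "inj_on (poly g) \<Lambda>"
      proof (rule inj_onI)
        fix x y assume xy: "x \<in> \<Lambda>" "y \<in> \<Lambda>" "poly g x = poly g y"
        obtain c d where c: "c > 0" "1 - x = complex_of_real c" "poly q x = x"
          and d: "d > 0" "1 - y = complex_of_real d" "poly q y = y"
          using eig xy by metis
        \<comment> \<open>On \<open>\<Lambda>\<close> the polynomial \<open>g\<close> acts as
          \<open>(1 - x)\<^sup>2\<close>, and a positive number is determined by its square.\<close>
        have "complex_of_real (c * c) = complex_of_real (d * d)"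
          using xy(3) unfolding of_real_mult c(2)[symmetric] d(2)[symmetric] g_def poly_mult poly_diff
          by (simp add: c(3) d(3))
        then have "c * c = d * d" by (simp only: of_real_eq_iff)
        then have "c = d" using c(1) d(1) by (simp add: square_eq_iff)
        then have "1 - x = 1 - y" using c(2) d(2) by simp
        then show "x = y" by simp
      qed
      then show ?thesis using True by (simp add: k_def inj_on_def)
    qed (simp add: k_def)
    have "klt M s F" if "unitary_matrix F" "diagonalizes F (\<phi> r)" for F
      using that diagonalizes_\<phi>_pcompose unitary_matrix_invertible unfolding klt by blast
    moreover have "(\<forall>F. klt M s F \<longrightarrow> unitary_matrix F \<and> diagonalizes F (\<phi> r)) \<longleftrightarrow> inj_on (poly g) \<Lambda>"
      using diagonalizes_pcompose_imp_iff_inj_on[OF ex, of k] inj unfolding klt \<Lambda>_def by blast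
    ultimately show ?thesis by blast
  qed
  have "\<Lambda> = {z. poly p z = 0}" if "r = [:0, 1:] mod p"
    unfolding \<Lambda>_def that by (auto simp: poly_mod_at_zero image_iff)
  then show ?thesis
    unfolding ft gen \<Lambda>_def[symmetric] using ex field by auto
qed

end
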